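(* Let $X$ be a Banach space, $G\in C^1(X,\mathbb{R})$, $M:=\{u\in X:G(u)=0\}$, and assume $G'(u)\neq0$ for every $u\in M$. Let $J\in C^1(X,\mathbb{R})$. Let $k\ge1$, let $K\subset\mathbb{R}^k$ be a compact subset and let $\Gamma\subset C^0(K,M)$. Assume that $$m:=\sup_{\gamma\in\Gamma}\max_{t\in\partial K}J(\gamma(t))<c:=\inf_{\gamma\in\Gamma}\max_{t\in K}J(\gamma(t)).$$ Moreover, assume that there exists $a\in(m,c)$ such that $\Gamma$ is invariant under homotopies that fix the sublevel set $J^a:=\{u\in M:J(u)<a\}$. Then, for any $\varepsilon>0$ and for any $\gamma\in\Gamma$ such that $$\max_{t\in K}J(\gamma(t))<c+\frac\varepsilon2,$$ there exists $u\in M$ such that 1. $|J(u)-c|<\varepsilon$, 2. $\|J'_M(u)\|_*<\sqrt\varepsilon$, 3. $\operatorname{dist}(u,\gamma(K))<\sqrt\varepsilon$.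
   Context: Under the assumption $G'(u)\ne0$ on $M$, $M$ is a $C^1$ manifold of codimension 1 with tangent space $T_uM=\operatorname{Ker}(G'(u))=\{v\in X:G'(u)[v]=0\}$ at $u\in M$. $J'_M(u)\in(T_uM)^*$ denotes the derivative at $u$ of $J$ constrained to $M$, i.e. the restriction of $J'(u)$ to $T_uM$, and for $F\in(T_uM)^*$, $\|F\|_*:=\sup\{|F[v]|:v\in T_uM,\ \|v\|_X=1\}$. For $u\in M$ and $C\subset X$, $\operatorname{dist}(u,C):=\inf_{v\in C}\|u-v\|_X$. $\partial K$ is the boundary of $K$ in $\mathbb{R}^k$. "$\Gamma$ is invariant under homotopies that fix $J^a$" means: for every continuous map $H:[0,1]\times M\to M$ with $H(0,u)=u$ for all $u\in M$ and $H(s,u)=u$ for all $s\in[0,1]$, $u\in J^a$, one has $H(1,\gamma(\cdot))\in\Gamma$ for every $\gamma\in\Gamma$. *)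

theory Defs
  imports "HOL-Analysis.Analysis"
begin

definition C1_functional :: "('a::real_normed_vector \<Rightarrow> real) \<Rightarrow> ('a \<Rightarrow> 'a \<Rightarrow>\<^sub>L real) \<Rightarrow> bool" where
  "C1_functional F F' \<longleftrightarrow>
     (\<forall>u. (F has_derivative blinfun_apply (F' u)) (at u)) \<and> continuous_on UNIV F'"

text \<open>Maps defined on \<open>K\<close> only are represented by functions that are \<open>undefined\<close> outside \<open>K\<close>,
  so that equality of elements of \<open>C0 K M\<close> is equality on \<open>K\<close>.\<close>

definition C0 :: "'b::topological_space set \<Rightarrow> 'a::topological_space set \<Rightarrow> ('b \<Rightarrow> 'a) set" where
  "C0 K M = {\<gamma> \<in> K \<rightarrow>\<^sub>E M. continuous_on K \<gamma>}"

definition tangent_space :: "('a::real_normed_vector \<Rightarrow> 'a \<Rightarrow>\<^sub>L real) \<Rightarrow> 'a \<Rightarrow> 'a set" where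
  "tangent_space G' u = {v. blinfun_apply (G' u) v = 0}"

definition constrained_derivative ::
    "('a::real_normed_vector \<Rightarrow> 'a \<Rightarrow>\<^sub>L real) \<Rightarrow> ('a \<Rightarrow> 'a \<Rightarrow>\<^sub>L real) \<Rightarrow> 'a \<Rightarrow> 'a \<Rightarrow> real" where
  "constrained_derivative G' J' u = restrict (blinfun_apply (J' u)) (tangent_space G' u)"

text \<open>The supremum is taken in \<open>[0,\<infinity>]\<close>, so the norm is \<open>0\<close> when \<open>T\<close> is the zero space and has no
  unit vectors.\<close>

definition dual_norm_on :: "'a::real_normed_vector set \<Rightarrow> ('a \<Rightarrow> real) \<Rightarrow> ennreal" where
  "dual_norm_on T F = (SUP v\<in>{v \<in> T. norm v = 1}. ennreal \<bar>F v\<bar>)"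

definition invariant_under_homotopies_fixing ::
    "('b \<Rightarrow> 'a) set \<Rightarrow> 'b set \<Rightarrow> 'a::topological_space set \<Rightarrow> 'a set \<Rightarrow> bool" where
  "invariant_under_homotopies_fixing \<Gamma> K M A \<longleftrightarrow>
     (\<forall>H :: real \<times> 'a \<Rightarrow> 'a.
        continuous_on ({0..1} \<times> M) H \<longrightarrow>
        H \<in> {0..1} \<times> M \<rightarrow> M \<longrightarrow>
        (\<forall>u\<in>M. H (0, u) = u) \<longrightarrow>
        (\<forall>s\<in>{0..1}. \<forall>u\<in>A. H (s, u) = u) \<longrightarrow>
        (\<forall>\<gamma>\<in>\<Gamma>. (\<lambda>t\<in>K. H (1, \<gamma> t)) \<in> \<Gamma>))"

text \<open>For \<open>S\<close> compact and nonempty and \<open>f\<close> continuous on \<open>S\<close> the supremum is attained, so this is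
  the maximum of \<open>f\<close> over \<open>S\<close>. Extended real values make the outer supremum and infimum over
  families of maps meaningful without boundedness assumptions.\<close>

definition max_over :: "'b set \<Rightarrow> ('b \<Rightarrow> real) \<Rightarrow> ereal" where
  "max_over S f = (SUP t\<in>S. ereal (f t))"

end

theory Submission
  imports Defs
begin

text \<open>No gradient flow is used, since a \<open>C\<^sup>1\<close> hypersurface carries no evident Lipschitz tangent
  fields. Instead Ekeland's variational principle is run on the maps \<open>\<gamma> \<in> \<Gamma>\<close> with the uniform metric
  and the functional \<open>\<gamma> \<mapsto> max J \<circ> \<gamma>\<close>. It yields a sequence in \<open>\<Gamma>\<close> converging uniformly to a map \<open>g\<close>,
  such that far out in the sequence no competitor in \<open>\<Gamma>\<close> lowers the functional at a rate of
  \<open>sqrt \<epsilon> / 2\<close> by a fixed amount. If the constrained derivative were at least \<open>sqrt \<epsilon>\<close> at all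
  near-maximum points of \<open>g\<close>, a single small step \<open>u + h V u + \<tau> W u\<close>, with \<open>V\<close> a descent field, \<open>W\<close>
  transversal to \<open>M\<close> and \<open>\<tau>\<close> chosen so that the step ends on \<open>M\<close>, would be such a competitor.\<close>

section \<open>Preliminaries from calculus and topology\<close>

lemma C1_functional_mean_value:
  assumes "C1_functional F F'" "0 < h"
  shows "\<exists>\<xi>. 0 < \<xi> \<and> \<xi> < h \<and> F (u + h *\<^sub>R x) - F u = h * F' (u + \<xi> *\<^sub>R x) x"
proof -
  have "((\<lambda>t. F (u + t *\<^sub>R x)) has_real_derivative F' (u + t *\<^sub>R x) x) (at t)" for t
  proof -
    have "(F has_derivative F' (u + t *\<^sub>R x)) (at (u + t *\<^sub>R x))"
      using assms(1) by (auto simp: C1_functional_def)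
    moreover have "((\<lambda>t. u + t *\<^sub>R x) has_derivative (\<lambda>t. t *\<^sub>R x)) (at t)"
      by (auto intro!: derivative_eq_intros)
    ultimately have "((\<lambda>t. F (u + t *\<^sub>R x)) has_derivative (\<lambda>s. F' (u + t *\<^sub>R x) (s *\<^sub>R x))) (at t)"
      using has_derivative_compose[of "\<lambda>t. u + t *\<^sub>R x" "\<lambda>t. t *\<^sub>R x" t UNIV F "F' (u + t *\<^sub>R x)"] by simp
    moreover have "(\<lambda>s. F' (u + t *\<^sub>R x) (s *\<^sub>R x)) = (*) (F' (u + t *\<^sub>R x) x)"
      by (auto simp: blinfun.scaleR_right mult.commute)
    ultimately show ?thesis
      by (simp add: has_field_derivative_def)
  qed
  then obtain z where "0 < z" "z < h"
    "F (u + h *\<^sub>R x) - F (u + 0 *\<^sub>R x) = (h - 0) * F' (u + z *\<^sub>R x) x"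
    using MVT2[of 0 h "\<lambda>t. F (u + t *\<^sub>R x)" "\<lambda>t. F' (u + t *\<^sub>R x) x"] assms(2) by blast
  then show ?thesis by auto
qed

lemma C1_functional_continuous_on:
  assumes "C1_functional F F'"
  shows "continuous_on S F"
  using assms has_derivative_continuous unfolding C1_functional_def
  by (metis continuous_at_imp_continuous_on)

text \<open>A partition of unity argument: one value works near each point of \<open>A\<close>,
  finitely many balls suffice, and convexity of \<open>P z\<close> absorbs the averaging. Halving
  the radii leaves room for \<open>f u\<close> to lie in \<open>P z\<close> for all \<open>z\<close>
  uniformly close to \<open>u\<close>, not just for \<open>z = u\<close>. This is what later
  controls derivatives at intermediate points of a step.\<close>

lemma continuous_selection_near_compact:
  fixes P :: "'a::metric_space \<Rightarrow> 'b::real_normed_vector set"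
  assumes "compact A" "A \<noteq> {}"
    and conv: "\<And>z. convex (P z)"
    and loc: "\<And>a. a \<in> A \<Longrightarrow> \<exists>x. \<forall>\<^sub>F z in nhds a. x \<in> P z"
  obtains r f where "0 < r" "continuous_on {u. infdist u A < r} f"
    "\<And>u z. infdist u A < r \<Longrightarrow> dist u z < r \<Longrightarrow> f u \<in> P z"
proof -
  have "\<forall>a. \<exists>x r. a \<in> A \<longrightarrow> 0 < r \<and> (\<forall>z. dist z a < r \<longrightarrow> x \<in> P z)"
    using loc unfolding eventually_nhds_metric by blast
  then obtain x r where r: "\<And>a. a \<in> A \<Longrightarrow> 0 < r a"
    and x: "\<And>a z. a \<in> A \<Longrightarrow> dist z a < r a \<Longrightarrow> x a \<in> P z"
    by metis
  have "A \<subseteq> (\<Union>a\<in>A. ball a (r a / 2))"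
    using r by force
  then obtain C where C: "C \<subseteq> A" "finite C" "A \<subseteq> (\<Union>a\<in>C. ball a (r a / 2))"
    using compactE_image[OF \<open>compact A\<close>, of A "\<lambda>a. ball a (r a / 2)"] by blast
  obtain e where e: "0 < e" "\<And>a. a \<in> A \<Longrightarrow> \<exists>c\<in>C. ball a e \<subseteq> ball c (r c / 2)"
    using Heine_Borel_lemma[OF \<open>compact A\<close> C(3)] by (metis (no_types, lifting) imageE open_ball)
  have "C \<noteq> {}" using C \<open>A \<noteq> {}\<close> by auto
  \<comment> \<open>The bound by the Lebesgue number \<open>e\<close> gives every point within
    \<open>R\<close> of \<open>A\<close> at least one positive weight. The bound by
    \<open>r c / 2\<close> keeps points within \<open>R\<close> of \<open>u\<close> inside the full
    ball of every \<open>c\<close> whose weight at \<open>u\<close> is positive.\<close>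
  define R where "R = min e (Min ((\<lambda>c. r c / 2) ` C))"
  have R: "0 < R" "R \<le> e"
    using e(1) C r \<open>C \<noteq> {}\<close> unfolding R_def by (auto simp: subset_eq)
  have R': "R \<le> r c / 2" if "c \<in> C" for c
    unfolding R_def using C(2) that by (intro min.coboundedI2 Min_le) auto
  define \<rho> where "\<rho> c u = max 0 (r c / 2 - dist u c)" for c u
  define f where "f u = (\<Sum>c\<in>C. (\<rho> c u / (\<Sum>c\<in>C. \<rho> c u)) *\<^sub>R x c)" for u
  have pos: "0 < (\<Sum>c\<in>C. \<rho> c u)" if "infdist u A < R" for u
  proof -
    have "bdd_below (dist u ` A)" by (rule bdd_belowI[of _ 0]) auto
    from cINF_less_iff[OF \<open>A \<noteq> {}\<close> this, of R] that obtain a where "a \<in> A" "dist u a < R"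
      unfolding infdist_notempty[OF \<open>A \<noteq> {}\<close>] by blast
    then obtain c where c: "c \<in> C" "ball a e \<subseteq> ball c (r c / 2)" using e by blast
    have "u \<in> ball a e" using \<open>dist u a < R\<close> R by (simp add: dist_commute)
    with c have "0 < \<rho> c u" by (auto simp: \<rho>_def dist_commute)
    with c show ?thesis by (intro sum_pos2[OF C(2) c(1)]) (auto simp: \<rho>_def)
  qed
  show thesis
  proof (rule that[OF R(1)])
    show "continuous_on {u. infdist u A < R} f"
      unfolding f_def \<rho>_def
      by (intro continuous_intros) (use pos in \<open>fastforce simp: \<rho>_def\<close>)
    fix u z assume u: "infdist u A < R" "dist u z < R"
    \<comment> \<open>Centres of zero weight may have \<open>x c\<close> outside \<open>P z\<close>,
      so convexity is applied to the active ones only.\<close>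
    let ?D = "{c \<in> C. 0 < \<rho> c u}"
    have D: "sum g ?D = sum g C" if "\<And>c. \<rho> c u = 0 \<Longrightarrow> g c = 0" for g :: "'a \<Rightarrow> 'c::comm_monoid_add"
    proof (rule sum.mono_neutral_left)
      have "\<rho> c u = 0" if "\<not> 0 < \<rho> c u" for c using that by (simp add: \<rho>_def)
      with that show "\<forall>c\<in>C - ?D. g c = 0" by blast
    qed (use C(2) in auto)
    have xP: "x c \<in> P z" if "c \<in> ?D" for c
    proof (rule x)
      have "dist z c \<le> dist u z + dist u c" by (metis dist_commute dist_triangle)
      then show "dist z c < r c"
        using that u R'[of c] by (auto simp: \<rho>_def max_def split: if_splits)
    qed (use that C in auto)
    have "(\<Sum>c\<in>?D. (\<rho> c u / (\<Sum>c\<in>C. \<rho> c u)) *\<^sub>R x c) \<in> P z"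
    proof (rule convex_sum[OF _ conv])
      show "(\<Sum>c\<in>?D. \<rho> c u / (\<Sum>c\<in>C. \<rho> c u)) = 1"
        using pos[OF u(1)] by (subst D) (auto simp: sum_divide_distrib[symmetric])
    qed (use C xP pos[OF u(1)] in auto)
    then show "f u \<in> P z" unfolding f_def by (subst (asm) D) auto
  qed
qed

text \<open>By monotonicity the sign of \<open>f p y\<close> tells on which side of \<open>y\<close>
  the root lies. For fixed \<open>y\<close> a strict sign persists near \<open>p\<close>, so both
  order conditions on \<open>T\<close> are open. This replaces the implicit function theorem when
  the dependence on \<open>p\<close> is merely continuous.\<close>

lemma continuous_on_monotone_root:
  fixes f :: "'a::topological_space \<Rightarrow> real \<Rightarrow> real" and T :: "'a \<Rightarrow> real"
  assumes cont: "\<And>y. continuous_on S (\<lambda>p. f p y)"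
    and root: "\<And>p. p \<in> S \<Longrightarrow> \<bar>T p\<bar> \<le> b \<and> f p (T p) = 0"
    and mono: "\<And>p y y'. p \<in> S \<Longrightarrow> - b \<le> y \<Longrightarrow> y < y' \<Longrightarrow> y' \<le> b \<Longrightarrow> f p y < f p y'"
  shows "continuous_on S T"
  unfolding continuous_on_def
proof (intro ballI order_tendstoI)
  fix p y assume p: "p \<in> S" and y: "y < T p"
  show "\<forall>\<^sub>F p' in at p within S. y < T p'"
  proof (cases "y < - b")
    case True
    have "y < T p'" if "p' \<in> S" for p' using root[OF that] True by auto
    then show ?thesis by (auto simp: eventually_at_filter)
  next
    case False
    then have "f p y < 0" using mono[OF p, of y "T p"] root[OF p] y by auto
    then have "\<forall>\<^sub>F p' in at p within S. f p' y < 0"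
      using cont[of y] p by (auto simp: continuous_on_def intro: order_tendstoD)
    moreover have "\<forall>\<^sub>F p' in at p within S. p' \<in> S" by (auto simp: eventually_at_filter)
    ultimately show ?thesis
    proof eventually_elim
      case (elim p')
      show ?case
      proof (rule ccontr)
        assume "\<not> y < T p'"
        then have "T p' < y \<or> T p' = y" by auto
        with mono[OF elim(2), of "T p'" y] root[OF elim(2)] elim(1) y root[OF p]
        show False by (smt (verit))
      qed
    qed
  qed
next
  fix p y assume p: "p \<in> S" and y: "T p < y"
  show "\<forall>\<^sub>F p' in at p within S. T p' < y"
  proof (cases "b < y")
    case True
    have "T p' < y" if "p' \<in> S" for p' using root[OF that] True by auto
    then show ?thesis by (auto simp: eventually_at_filter)
  next
    case False
    then have "0 < f p y" using mono[OF p, of "T p" y] root[OF p] y by auto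
    then have "\<forall>\<^sub>F p' in at p within S. 0 < f p' y"
      using cont[of y] p by (auto simp: continuous_on_def intro: order_tendstoD)
    moreover have "\<forall>\<^sub>F p' in at p within S. p' \<in> S" by (auto simp: eventually_at_filter)
    ultimately show ?thesis
    proof eventually_elim
      case (elim p')
      show ?case
      proof (rule ccontr)
        assume "\<not> T p' < y"
        then have "y < T p' \<or> T p' = y" by auto
        with mono[OF elim(2), of y "T p'"] root[OF elim(2)] elim(1) y root[OF p]
        show False by (smt (verit))
      qed
    qed
  qed
qed

text \<open>A Lebesgue number for a cover of the compact image of \<open>g\<close> makes the
  continuity of \<open>f\<close> uniform near that image, even though the values of
  \<open>x n\<close> may lie outside it.\<close>

lemma uniform_limit_compose_near_compact:
  fixes f :: "'b::metric_space \<Rightarrow> 'c::metric_space"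
  assumes lim: "uniform_limit K x g F" and "compact (g ` K)" "g ` K \<subseteq> M"
    and cont: "continuous_on M f" and xM: "\<And>n t. t \<in> K \<Longrightarrow> x n t \<in> M"
  shows "uniform_limit K (\<lambda>n t. f (x n t)) (\<lambda>t. f (g t)) F"
proof (rule uniform_limitI)
  fix e :: real assume "0 < e"
  have "\<forall>a. \<exists>d. a \<in> g ` K \<longrightarrow> 0 < d \<and> (\<forall>y\<in>M. dist y a < d \<longrightarrow> dist (f y) (f a) < e / 2)"
    using cont assms(3) \<open>0 < e\<close> unfolding continuous_on_iff by (meson half_gt_zero subsetD)
  then obtain d where d: "\<And>a. a \<in> g ` K \<Longrightarrow> 0 < d a"
    "\<And>a y. a \<in> g ` K \<Longrightarrow> y \<in> M \<Longrightarrow> dist y a < d a \<Longrightarrow> dist (f y) (f a) < e / 2"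
    by metis
  obtain r where r: "0 < r"
    "\<And>y. y \<in> g ` K \<Longrightarrow> \<exists>B \<in> (\<lambda>a. ball a (d a)) ` g ` K. ball y r \<subseteq> B"
  proof (rule Heine_Borel_lemma[OF assms(2), of "(\<lambda>a. ball a (d a)) ` g ` K"])
    show "g ` K \<subseteq> \<Union> ((\<lambda>a. ball a (d a)) ` g ` K)" using d(1) by fastforce
  qed auto
  show "\<forall>\<^sub>F n in F. \<forall>t\<in>K. dist (f (x n t)) (f (g t)) < e"
    using uniform_limitD[OF lim r(1)]
  proof (eventually_elim, intro ballI)
    fix n t assume n: "\<forall>t\<in>K. dist (x n t) (g t) < r" and t: "t \<in> K"
    then obtain a where a: "a \<in> g ` K" "ball (g t) r \<subseteq> ball a (d a)" using r(2)[of "g t"] by auto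
    have "dist (x n t) a < d a" "dist (g t) a < d a"
      using a(2) n t r(1) by (auto simp: subset_eq dist_commute)
    then have "dist (f (x n t)) (f a) < e / 2" "dist (f (g t)) (f a) < e / 2"
      using d(2)[OF a(1)] xM t assms(3) by blast+
    then show "dist (f (x n t)) (f (g t)) < e" using dist_triangle_half_r[of "f a" "f (x n t)" e "f (g t)"] by (simp add: dist_commute)
  qed
qed

section \<open>Ekeland's iteration and maxima over compact sets\<close>

text \<open>Each term nearly minimises \<open>F\<close> among the \<open>R\<close>-successors of the
  previous one. No limit is taken here, because the limit of the sequence may leave the set
  \<open>S\<close>.\<close>

lemma ekeland_sequence:
  fixes F :: "'a \<Rightarrow> real"
  assumes "x0 \<in> S" and bdd: "\<And>x. x \<in> S \<Longrightarrow> b \<le> F x" and refl: "\<And>x. x \<in> S \<Longrightarrow> R x x"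
  obtains x where "x 0 = x0" "\<And>n. x n \<in> S" "\<And>n. R (x n) (x (Suc n))"
    "\<And>n y. y \<in> S \<Longrightarrow> R (x n) y \<Longrightarrow> F (x (Suc n)) \<le> F y + (1/2) ^ n"
proof -
  have "\<exists>x. \<forall>n. (x n \<in> S \<and> (n = 0 \<longrightarrow> x n = x0)) \<and> (x (Suc n) \<in> S \<and> R (x n) (x (Suc n)) \<and>
      (\<forall>y\<in>S. R (x n) y \<longrightarrow> F (x (Suc n)) \<le> F y + (1/2) ^ n))"
  proof (rule dependent_nat_choice)
    fix x and n :: nat assume x: "x \<in> S \<and> (n = 0 \<longrightarrow> x = x0)"
    define Y where "Y = {y\<in>S. R x y}"
    have Y: "x \<in> Y" "bdd_below (F ` Y)"
      using x refl bdd by (auto simp: Y_def intro!: bdd_belowI[of _ b])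
    have "(INF y\<in>Y. F y) < (INF y\<in>Y. F y) + (1/2) ^ n" by simp
    then obtain y where "y \<in> Y" "F y < (INF y\<in>Y. F y) + (1/2) ^ n"
      using Y by (subst (asm) cINF_less_iff) auto
    moreover have "(INF y\<in>Y. F y) \<le> F z" if "z \<in> Y" for z
      using Y that by (intro cINF_lower)
    ultimately show "\<exists>y. (y \<in> S \<and> (Suc n = 0 \<longrightarrow> y = x0)) \<and> y \<in> S \<and> R x y \<and>
        (\<forall>z\<in>S. R x z \<longrightarrow> F y \<le> F z + (1/2) ^ n)"
      unfolding Y_def by (force simp: algebra_simps)
  qed (use assms in auto)
  then show thesis using that by blast
qed

lemma max_over_eq_cSUP:
  fixes f :: "'b::topological_space \<Rightarrow> real"
  assumes "compact S" "S \<noteq> {}" "continuous_on S f"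
  shows "max_over S f = ereal (SUP t\<in>S. f t)" "\<exists>t\<in>S. f t = (SUP t\<in>S. f t)"
    "\<And>t. t \<in> S \<Longrightarrow> f t \<le> (SUP t\<in>S. f t)"
proof -
  obtain t where t: "t \<in> S" "\<And>s. s \<in> S \<Longrightarrow> f s \<le> f t"
    using continuous_attains_sup[OF assms] by blast
  then have *: "(SUP t\<in>S. f t) = f t"
    by (intro cSup_eq_maximum) auto
  show "max_over S f = ereal (SUP t\<in>S. f t)"
    unfolding * max_over_def using t by (intro antisym SUP_least SUP_upper) auto
  show "\<exists>t\<in>S. f t = (SUP t\<in>S. f t)" "\<And>t. t \<in> S \<Longrightarrow> f t \<le> (SUP t\<in>S. f t)"
    using t * by auto
qed

section \<open>Deformation inside the constraint set\<close>

text \<open>Points near \<open>A\<close> move by a descent step corrected transversally so as to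
  land on \<open>M\<close>, and a cutoff turns this into the identity farther away. The constants
  come from \<open>9/8 = 1 + 1/8\<close>, the sizes of the two directions, and
  \<open>3/4 = 7/8 - 1/8\<close>, the descent rate minus the worst effect of the correction.\<close>

lemma constrained_deformation:
  fixes G J :: "'a::real_normed_vector \<Rightarrow> real"
  assumes G: "C1_functional G G'" and J: "C1_functional J J'"
    and M: "M = {u. G u = 0}"
    and A: "compact A" "A \<subseteq> M" and regular: "\<And>u. u \<in> A \<Longrightarrow> G' u \<noteq> 0"
    and above: "\<And>u. u \<in> A \<Longrightarrow> a < J u"
    and descent: "\<And>u. u \<in> A \<Longrightarrow> \<exists>v. norm v = 1 \<and> G' u v = 0 \<and> J' u v < - (7/8 * q)"
    and "0 < q" "0 < \<delta>"
  obtains s H where "0 < s" "s \<le> \<delta>" "continuous_on ({0..1} \<times> M) H" "H \<in> {0..1::real} \<times> M \<rightarrow> M"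
    "\<And>u. u \<in> M \<Longrightarrow> H (0, u) = u"
    "\<And>\<sigma> u. \<sigma> \<in> {0..1} \<Longrightarrow> u \<in> M \<Longrightarrow> J u \<le> a \<Longrightarrow> H (\<sigma>, u) = u"
    "\<And>u. u \<in> M \<Longrightarrow> dist (H (1, u)) u \<le> 9/8 * s"
    "\<And>u. u \<in> M \<Longrightarrow> J (H (1, u)) \<le> J u"
    "\<And>u. u \<in> A \<Longrightarrow> J (H (1, u)) \<le> J u - 3/4 * q * s"
\<comment> \<open>\<open>infdist\<close> to the empty set is 0, so a cutoff by distance would be
  useless there; the constant homotopy serves instead.\<close>
proof (cases "A = {}")
  case True
  show thesis
    by (rule that[of \<delta> snd]) (use True \<open>0 < \<delta>\<close> in \<open>auto intro: continuous_intros\<close>)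
next
  case False
  have contG: "continuous_on UNIV G'" and contJ: "continuous_on UNIV J'"
    using G J by (auto simp: C1_functional_def)
  \<comment> \<open>\<open>v\<close> is a descent direction and \<open>w\<close> a small direction transversal to \<open>M\<close> that outweighs the
    deviation of \<open>v\<close> from tangency. All conditions are jointly convex in \<open>(v, w)\<close> and, at fixed
    \<open>(v, w)\<close>, open in \<open>z\<close>, so local choices can be glued continuously.\<close>
  define P where "P z = {(v, w). norm v \<le> 1 \<and> norm w \<le> 1/8 \<and> J' z v < - (7/8 * q) \<and>
    \<bar>J' z w\<bar> < q / 8 \<and> \<bar>G' z v\<bar> < G' z w \<and> a < J z}" for z
  have conv: "convex (P z)" for z
  proof (rule convexI)
    fix x y and \<alpha> \<beta> :: real
    assume x: "x \<in> P z" and y: "y \<in> P z" and ab: "0 \<le> \<alpha>" "0 \<le> \<beta>" "\<alpha> + \<beta> = 1"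
    obtain v w v' w' where [simp]: "x = (v, w)" "y = (v', w')" by fastforce
    have cvx: "\<alpha> * s + \<beta> * t \<le> b" if "s \<le> b" "t \<le> b" for s t b
      using convex_bound_le[OF that ab] .
    have cvx': "\<alpha> * s + \<beta> * t < b" if "s < b" "t < b" for s t b
      using convex_bound_lt[OF that ab] .
    have n: "norm (\<alpha> *\<^sub>R x + \<beta> *\<^sub>R y) \<le> b" if "norm x \<le> b" "norm y \<le> b" for x y :: 'a and b
      using norm_triangle_ineq[of "\<alpha> *\<^sub>R x" "\<beta> *\<^sub>R y"] cvx[OF that] ab by simp
    have comb: "\<alpha> * J' z v + \<beta> * J' z v' < - (7/8 * q)"
      "\<alpha> * J' z w + \<beta> * J' z w' < q/8" "\<alpha> * (- J' z w) + \<beta> * (- J' z w') < q/8"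
      "\<alpha> * (G' z v - G' z w) + \<beta> * (G' z v' - G' z w') < 0"
      "\<alpha> * (- G' z v - G' z w) + \<beta> * (- G' z v' - G' z w') < 0"
      by (rule cvx'; use x y in \<open>force simp: P_def\<close>)+
    have "\<bar>\<alpha> * J' z w + \<beta> * J' z w'\<bar> < q/8"
      using comb(2,3) by (simp only: abs_less_iff mult_minus_right minus_add_distrib)
    moreover have "\<bar>\<alpha> * G' z v + \<beta> * G' z v'\<bar> < \<alpha> * G' z w + \<beta> * G' z w'"
      using comb(4,5) by (simp add: abs_less_iff algebra_simps)
    moreover have "norm (\<alpha> *\<^sub>R v + \<beta> *\<^sub>R v') \<le> 1" "norm (\<alpha> *\<^sub>R w + \<beta> *\<^sub>R w') \<le> 1/8" "a < J z"
      by (rule n; use x y in \<open>force simp: P_def\<close>)+ (use x in \<open>auto simp: P_def\<close>)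
    ultimately show "\<alpha> *\<^sub>R x + \<beta> *\<^sub>R y \<in> P z"
      using comb(1) by (simp add: P_def blinfun.add_right blinfun.scaleR_right)
  qed
  have loc: "\<exists>x. \<forall>\<^sub>F z in nhds b. x \<in> P z" if b: "b \<in> A" for b
  proof -
    obtain v where v: "norm v = 1" "G' b v = 0" "J' b v < - (7/8 * q)" using descent[OF b] by blast
    obtain w0 where w0: "G' b w0 \<noteq> 0"
      using regular[OF b] by (metis blinfun_eqI zero_blinfun.rep_eq)
    define w1 where "w1 = sgn (G' b w0) *\<^sub>R w0"
    have w1: "0 < G' b w1" using w0 by (simp add: w1_def blinfun.scaleR_right sgn_if)
    \<comment> \<open>The scaling keeps the orientation of \<open>w1\<close> and makes both
      \<open>norm w\<close> and the change of \<open>J\<close> along \<open>w\<close> small.\<close>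
    define w where "w = (1 / (8 * (1 + norm w1 + 8 * \<bar>J' b w1\<bar> / q))) *\<^sub>R w1"
    have den: "1 + norm w1 + 8 * \<bar>J' b w1\<bar> / q > 0" using \<open>0 < q\<close> by (simp add: add_pos_nonneg)
    have "0 < G' b w" using w1 den by (simp add: w_def blinfun.scaleR_right)
    moreover have "norm w \<le> 1/8"
      using den \<open>0 < q\<close> by (simp add: w_def field_simps)
    moreover have "\<bar>J' b w\<bar> < q / 8"
    proof -
      have "8 * \<bar>J' b w1\<bar> < q * (8 * (1 + norm w1 + 8 * \<bar>J' b w1\<bar> / q))"
        using \<open>0 < q\<close> by (simp add: field_simps add_pos_nonneg)
      then show ?thesis
        using den by (simp add: w_def blinfun.scaleR_right abs_mult divide_simps)
    qed
    moreover note v above[OF b]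
    moreover have "isCont (\<lambda>z. J' z v) b" "isCont (\<lambda>z. J' z w) b" "isCont (\<lambda>z. G' z v) b"
      "isCont (\<lambda>z. G' z w) b" "isCont J b"
      using contG contJ C1_functional_continuous_on[OF J, of UNIV]
      by (auto intro!: continuous_intros simp: continuous_on_eq_continuous_at)
    moreover have "\<forall>\<^sub>F z in nhds b. f z < g z" if "isCont f b" "isCont g b" "f b < g b" for f g :: "'a \<Rightarrow> real"
    proof -
      have "isCont (\<lambda>z. g z - f z) b" using that by (intro continuous_intros)
      from order_tendstoD(1)[OF this[unfolded continuous_at], of 0] that(3)
      have "\<forall>\<^sub>F z in at b. f z < g z" by simp
      with that(3) show ?thesis by (simp add: eventually_nhds_conv_at)
    qed
    ultimately have "\<forall>\<^sub>F z in nhds b. J' z v < - (7/8 * q)" "\<forall>\<^sub>F z in nhds b. \<bar>J' z w\<bar> < q / 8"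
      "\<forall>\<^sub>F z in nhds b. \<bar>G' z v\<bar> < G' z w" "\<forall>\<^sub>F z in nhds b. a < J z" "norm v \<le> 1" "norm w \<le> 1/8"
      by (auto simp: continuous_rabs)
    then have "\<forall>\<^sub>F z in nhds b. (v, w) \<in> P z"
      by (simp add: P_def eventually_conj_iff)
    then show ?thesis by blast
  qed
  obtain R f where "0 < R" and f: "continuous_on {u. infdist u A < R} f"
    and fP: "\<And>u z. infdist u A < R \<Longrightarrow> dist u z < R \<Longrightarrow> f u \<in> P z"
    using continuous_selection_near_compact[OF A(1) False conv loc] by blast
  define V W where "V u = fst (f u)" and "W u = snd (f u)" for u
  have contV: "continuous_on {u. infdist u A < R} V" and contW: "continuous_on {u. infdist u A < R} W"
    unfolding V_def W_def by (intro continuous_intros f)+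
  \<comment> \<open>With \<open>9/8 * s < R\<close>, all intermediate points of a step of size at
    most \<open>s\<close> stay within reach of \<open>fP\<close>.\<close>
  define s where "s = min \<delta> (R / 2)"
  have s: "0 < s" "s \<le> \<delta>" "9/8 * s < R" using \<open>0 < R\<close> \<open>0 < \<delta>\<close> by (auto simp: s_def)
  have nrm: "norm (V u) \<le> 1" "norm (W u) \<le> 1/8" and aJ: "a < J u" if "infdist u A < R" for u
    using fP[OF that, of u] \<open>0 < R\<close> by (auto simp: P_def V_def W_def)
  have bnd: "norm (y *\<^sub>R V u + t *\<^sub>R W u) \<le> 9/8 * b"
    if "infdist u A < R" "\<bar>y\<bar> \<le> b" "\<bar>t\<bar> \<le> b" for u y t b
  proof -
    have "norm (y *\<^sub>R V u + t *\<^sub>R W u) \<le> \<bar>y\<bar> * norm (V u) + \<bar>t\<bar> * norm (W u)"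
      by (metis norm_scaleR norm_triangle_ineq)
    also have "\<dots> \<le> b * 1 + b * (1/8)"
      using that nrm[OF that(1)] by (intro add_mono mult_mono) auto
    finally show ?thesis by simp
  qed
  have PV: "(V u, W u) \<in> P (u + y *\<^sub>R V u + t *\<^sub>R W u)"
    if "infdist u A < R" "\<bar>y\<bar> \<le> s" "\<bar>t\<bar> \<le> s" for u y t
  proof -
    have "dist u (u + y *\<^sub>R V u + t *\<^sub>R W u) < R"
      using bnd[OF that] s by (metis add.assoc add_diff_cancel_left' dist_commute dist_norm le_less_trans)
    then show ?thesis using fP[OF that(1)] by (simp add: V_def W_def)
  qed
  have mono: "G (u + y *\<^sub>R V u + t *\<^sub>R W u) < G (u + y *\<^sub>R V u + t' *\<^sub>R W u)"
    if u: "infdist u A < R" "\<bar>y\<bar> \<le> s" and t: "- s \<le> t" "t < t'" "t' \<le> s" for u y t t'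
  proof -
    from t have "0 < t' - t" by simp
    have eq: "u + y *\<^sub>R V u + t *\<^sub>R W u + r *\<^sub>R W u = u + y *\<^sub>R V u + (t + r) *\<^sub>R W u" for r
      by (simp add: scaleR_add_left)
    have eq': "t + (t' - t) = t'" by simp
    obtain \<xi> where \<xi>: "0 < \<xi>" "\<xi> < t' - t" "G (u + y *\<^sub>R V u + t' *\<^sub>R W u) - G (u + y *\<^sub>R V u + t *\<^sub>R W u)
        = (t' - t) * G' (u + y *\<^sub>R V u + (t + \<xi>) *\<^sub>R W u) (W u)"
      using C1_functional_mean_value[OF G \<open>0 < t' - t\<close>, of "u + y *\<^sub>R V u + t *\<^sub>R W u" "W u"]
      unfolding eq eq' by blast
    have "\<bar>t + \<xi>\<bar> \<le> s" using \<xi>(1,2) t by linarith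
    then have "0 < G' (u + y *\<^sub>R V u + (t + \<xi>) *\<^sub>R W u) (W u)"
      using PV[OF u, of "t + \<xi>"] by (auto simp: P_def)
    from mult_pos_pos[OF \<open>0 < t' - t\<close> this] show ?thesis
      unfolding \<xi>(3)[symmetric] by simp
  qed
  \<comment> \<open>Since the derivative along \<open>W\<close> dominates that along
    \<open>V\<close> in absolute value, \<open>G\<close> increases from 0 along \<open>V + W\<close>
    and decreases from 0 along \<open>V - W\<close>. So \<open>G\<close> changes sign between
    \<open>t = - h\<close> and \<open>t = h\<close>, which also bounds the correction by the
    step.\<close>
  have ex: "\<exists>t. \<bar>t\<bar> \<le> h \<and> G (u + h *\<^sub>R V u + t *\<^sub>R W u) = 0"
    if u: "u \<in> M" "infdist u A < R" and h: "0 \<le> h" "h \<le> s" for u h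
  proof (cases "h = 0")
    case True
    then show ?thesis using u by (auto simp: M intro!: exI[of _ 0])
  next
    case False
    then have "0 < h" using h by simp
    have eq: "u + r *\<^sub>R (V u + W u) = u + r *\<^sub>R V u + r *\<^sub>R W u"
      "u + r *\<^sub>R (V u - W u) = u + r *\<^sub>R V u + (- r) *\<^sub>R W u" for r
      by (simp_all add: scaleR_add_right scaleR_diff_right)
    have "G u = 0" using u by (simp add: M)
    obtain \<xi> where \<xi>: "0 < \<xi>" "\<xi> < h" "G (u + h *\<^sub>R V u + h *\<^sub>R W u)
        = h * G' (u + \<xi> *\<^sub>R V u + \<xi> *\<^sub>R W u) (V u + W u)"
      using C1_functional_mean_value[OF G \<open>0 < h\<close>, of u "V u + W u"]
      unfolding eq \<open>G u = 0\<close> diff_0_right by blast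
    obtain \<zeta> where \<zeta>: "0 < \<zeta>" "\<zeta> < h" "G (u + h *\<^sub>R V u + (- h) *\<^sub>R W u)
        = h * G' (u + \<zeta> *\<^sub>R V u + (- \<zeta>) *\<^sub>R W u) (V u - W u)"
      using C1_functional_mean_value[OF G \<open>0 < h\<close>, of u "V u - W u"]
      unfolding eq \<open>G u = 0\<close> diff_0_right by blast
    have "0 < G' (u + \<xi> *\<^sub>R V u + \<xi> *\<^sub>R W u) (V u + W u)"
      using PV[OF u(2), of \<xi> \<xi>] \<xi> h by (auto simp: P_def blinfun.add_right)
    then have 1: "0 \<le> G (u + h *\<^sub>R V u + h *\<^sub>R W u)" using \<xi> \<open>0 < h\<close> by simp
    have "G' (u + \<zeta> *\<^sub>R V u + (- \<zeta>) *\<^sub>R W u) (V u - W u) < 0"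
      using PV[OF u(2), of \<zeta> "- \<zeta>"] \<zeta> h by (auto simp: P_def blinfun.diff_right)
    then have 2: "G (u + h *\<^sub>R V u + (- h) *\<^sub>R W u) \<le> 0"
      unfolding \<zeta>(3) using \<open>0 < h\<close> by (simp add: mult_le_0_iff)
    have "continuous_on {-h..h} (\<lambda>t. G (u + h *\<^sub>R V u + t *\<^sub>R W u))"
      by (intro continuous_on_compose2[OF C1_functional_continuous_on[OF G, of UNIV]] continuous_intros) auto
    then obtain t where "- h \<le> t" "t \<le> h" "G (u + h *\<^sub>R V u + t *\<^sub>R W u) = 0"
      using IVT'[of "\<lambda>t. G (u + h *\<^sub>R V u + t *\<^sub>R W u)" "- h" 0 h] 1 2 \<open>0 < h\<close> by auto
    then show ?thesis by (intro exI[of _ t]) auto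
  qed
  \<comment> \<open>The step is \<open>s\<close> on \<open>A\<close> at time 1, and vanishes at
    distance \<open>R / 2\<close> and beyond. Between \<open>R / 2\<close> and \<open>R\<close> the
    corrected step and the identity overlap.\<close>
  define h where "h p = fst p * s * max 0 (1 - 2 * infdist (snd p) A / R)" for p :: "real \<times> 'a"
  have h: "0 \<le> h (\<sigma>, u)" "h (\<sigma>, u) \<le> s" if "\<sigma> \<in> {0..1}" for \<sigma> u
  proof -
    have "max 0 (1 - 2 * infdist u A / R) \<in> {0..1}"
      using \<open>0 < R\<close> infdist_nonneg[of u A] by (auto simp: field_simps)
    then have "\<sigma> * max 0 (1 - 2 * infdist u A / R) \<in> {0..1}"
      using that by (auto intro: mult_le_one)
    moreover have "h (\<sigma>, u) = s * (\<sigma> * max 0 (1 - 2 * infdist u A / R))"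
      by (simp add: h_def)
    ultimately show "0 \<le> h (\<sigma>, u)" "h (\<sigma>, u) \<le> s"
      using s(1) by (auto simp only: atLeastAtMost_iff intro: mult_nonneg_nonneg mult_left_le less_imp_le)
  qed
  define g where "g p t = snd p + h p *\<^sub>R V (snd p) + t *\<^sub>R W (snd p)" for p t
  \<comment> \<open>By \<open>mono\<close> the root is unique even in the larger interval \<open>{-s..s}\<close>, which makes it continuous.\<close>
  define T where "T p = (SOME t. \<bar>t\<bar> \<le> h p \<and> G (g p t) = 0)" for p
  define N where "N = {0..1::real} \<times> {u \<in> M. infdist u A < R}"
  have T: "\<bar>T p\<bar> \<le> h p" "G (g p (T p)) = 0" if "p \<in> N" for p
  proof -
    have "\<exists>t. \<bar>t\<bar> \<le> h p \<and> G (g p t) = 0"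
      unfolding g_def using that h by (intro ex) (auto simp: N_def)
    from someI_ex[OF this] show "\<bar>T p\<bar> \<le> h p" "G (g p (T p)) = 0" unfolding T_def by blast+
  qed
  have conth: "continuous_on N h"
    unfolding h_def by (intro continuous_intros) (use \<open>0 < R\<close> in auto)
  have contVW: "continuous_on N (\<lambda>p. V (snd p))" "continuous_on N (\<lambda>p. W (snd p))"
    by (rule continuous_on_compose2[OF contV] continuous_on_compose2[OF contW];
        auto simp: N_def intro: continuous_intros)+
  have contT: "continuous_on N T"
  proof (rule continuous_on_monotone_root[where f = "\<lambda>p t. G (g p t)" and b = s])
    show "continuous_on N (\<lambda>p. G (g p y))" for y
      unfolding g_def
      by (intro continuous_on_compose2[OF C1_functional_continuous_on[OF G, of UNIV]]
          continuous_intros conth contVW) auto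
    show "\<bar>T p\<bar> \<le> s \<and> G (g p (T p)) = 0" if "p \<in> N" for p
      using T[OF that] that h(2)[of "fst p" "snd p"] by (auto simp: N_def)
    show "G (g p y) < G (g p y')" if "p \<in> N" "- s \<le> y" "y < y'" "y' \<le> s" for p y y'
      unfolding g_def using that h by (intro mono) (auto simp: N_def)
  qed
  define H where "H p = (if infdist (snd p) A < R then g p (T p) else snd p)" for p
  \<comment> \<open>A zero step forces a zero correction, since \<open>T p\<close> is bounded by
    \<open>h p\<close>. Hence the two branches of \<open>H\<close> agree on the overlap.\<close>
  have Hid: "H p = snd p" if "p \<in> {0..1} \<times> M" "h p = 0" for p
    using T(1)[of p] that by (auto simp: H_def N_def g_def)
  have HM: "H p \<in> M" if "p \<in> {0..1} \<times> M" for p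
    using T(2)[of p] that by (auto simp: H_def N_def M)
  have far: "h p = 0" if "R / 2 < infdist (snd p) A" for p
  proof -
    have "1 - 2 * infdist (snd p) A / R \<le> 0" using that \<open>0 < R\<close> by (simp add: field_simps)
    then show ?thesis by (simp add: h_def)
  qed
  have est: "dist (H p) (snd p) \<le> 9/8 * h p \<and> J (H p) \<le> J (snd p) - 3/4 * q * h p"
    if p: "p \<in> {0..1} \<times> M" for p
  proof (cases "h p = 0")
    case True
    then show ?thesis using Hid[OF p] by simp
  next
    case False
    obtain \<sigma> u where pu: "p = (\<sigma>, u)" by fastforce
    with p have hp: "0 \<le> h p" "h p \<le> s" using h by auto
    with False have "0 < h p" by simp
    have u: "infdist u A < R" using far[of p] False \<open>0 < R\<close> pu by force
    then have "p \<in> N" using p by (auto simp: N_def pu)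
    note Tp = T(1)[OF this]
    have Hp: "H p = u + h p *\<^sub>R V u + T p *\<^sub>R W u" using u by (simp add: H_def g_def pu)
    have distH: "dist (H p) u \<le> 9/8 * h p"
      using bnd[OF u _ Tp, of "h p"] hp by (simp add: Hp dist_norm add.assoc)
    \<comment> \<open>The quotient makes the displacement a multiple of the single vector
      \<open>V u + \<theta> *\<^sub>R W u\<close>, so one application of the mean value theorem
      along a segment suffices.\<close>
    define \<theta> where "\<theta> = T p / h p"
    have \<theta>: "\<bar>\<theta>\<bar> \<le> 1" "T p = h p * \<theta>" using Tp \<open>0 < h p\<close> by (auto simp: \<theta>_def field_simps)
    have eq: "u + r *\<^sub>R (V u + \<theta> *\<^sub>R W u) = u + r *\<^sub>R V u + (r * \<theta>) *\<^sub>R W u" for r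
      by (simp add: scaleR_add_right)
    obtain \<xi> where \<xi>: "0 < \<xi>" "\<xi> < h p" "J (H p) - J u
        = h p * J' (u + \<xi> *\<^sub>R V u + (\<xi> * \<theta>) *\<^sub>R W u) (V u + \<theta> *\<^sub>R W u)"
      using C1_functional_mean_value[OF J \<open>0 < h p\<close>, of u "V u + \<theta> *\<^sub>R W u"]
      unfolding eq Hp \<theta>(2) by blast
    let ?z = "u + \<xi> *\<^sub>R V u + (\<xi> * \<theta>) *\<^sub>R W u"
    have "\<xi> * \<bar>\<theta>\<bar> \<le> \<xi> * 1" using \<theta>(1) \<xi>(1) by (intro mult_left_mono) auto
    moreover have "\<bar>\<xi> * \<theta>\<bar> = \<xi> * \<bar>\<theta>\<bar>" using \<xi>(1) by (simp add: abs_mult)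
    ultimately have "\<bar>\<xi> * \<theta>\<bar> \<le> s" using \<xi>(2) hp(2) by linarith
    then have z: "J' ?z (V u) < - (7/8 * q)" "\<bar>J' ?z (W u)\<bar> < q / 8"
      using PV[OF u, of \<xi> "\<xi> * \<theta>"] \<xi> hp by (auto simp: P_def)
    have "\<theta> * J' ?z (W u) \<le> q / 8"
    proof -
      have "\<bar>\<theta>\<bar> * \<bar>J' ?z (W u)\<bar> \<le> \<bar>J' ?z (W u)\<bar>"
        using \<theta>(1) mult_right_mono[of "\<bar>\<theta>\<bar>" 1 "\<bar>J' ?z (W u)\<bar>"] by simp
      then show ?thesis using z(2) by (simp add: abs_mult[symmetric])
    qed
    with z have "J' ?z (V u + \<theta> *\<^sub>R W u) \<le> - (3/4 * q)"
      by (simp add: blinfun.add_right blinfun.scaleR_right)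
    then have "J (H p) - J u \<le> h p * - (3/4 * q)"
      unfolding \<xi>(3) using hp by (intro mult_left_mono)
    with distH show ?thesis by (simp add: pu algebra_simps)
  qed
  show thesis
  proof (rule that[OF s(1,2)])
    let ?D = "{0..1::real} \<times> M"
    \<comment> \<open>\<open>N\<close> and \<open>S\<close> are relatively open and cover the
      domain, so continuity can be checked on each separately.\<close>
    define S where "S = ?D \<inter> {p. R / 2 < infdist (snd p) A}"
    have D: "?D = N \<union> S" using \<open>0 < R\<close> by (auto simp: N_def S_def)
    have "continuous_on (N \<union> S) H"
    proof (rule continuous_on_Un_local_open)
      have "N = ?D \<inter> {p. infdist (snd p) A < R}" by (auto simp: N_def)
      moreover have "open {p :: real \<times> 'a. infdist (snd p) A < R}"
        by (intro open_Collect_less continuous_intros)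
      ultimately show "openin (top_of_set (N \<union> S)) N"
        unfolding D[symmetric] by (metis openin_open_Int)
      have "open {p :: real \<times> 'a. R / 2 < infdist (snd p) A}"
        by (intro open_Collect_less continuous_intros)
      then show "openin (top_of_set (N \<union> S)) S"
        unfolding D[symmetric] by (metis S_def openin_open_Int)
      have "continuous_on N (\<lambda>p. g p (T p))"
        unfolding g_def by (intro continuous_intros conth contVW contT)
      then show "continuous_on N H"
        by (rule continuous_on_eq) (auto simp: H_def N_def)
      have "continuous_on S snd" by (intro continuous_intros)
      then show "continuous_on S H"
        by (rule continuous_on_eq) (auto simp: S_def far Hid)
    qed
    then show "continuous_on ?D H" by (simp add: D)
    show "H \<in> ?D \<rightarrow> M" using HM by blast
    show "H (0, u) = u" if "u \<in> M" for u using Hid[of "(0, u)"] that by (simp add: h_def)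
    show "H (\<sigma>, u) = u" if "\<sigma> \<in> {0..1}" "u \<in> M" "J u \<le> a" for \<sigma> u
      using aJ[of u] that by (auto simp: H_def)
    show "dist (H (1, u)) u \<le> 9/8 * s" if "u \<in> M" for u
      using est[of "(1, u)"] h(2)[of 1 u] that by auto
    show "J (H (1, u)) \<le> J u" if "u \<in> M" for u
      using est[of "(1, u)"] h(1)[of 1 u] that \<open>0 < q\<close> by (auto intro: order_trans)
    show "J (H (1, u)) \<le> J u - 3/4 * q * s" if "u \<in> A" for u
      using est[of "(1, u)"] that A by (auto simp: h_def)
  qed
qed

section \<open>The minimax argument\<close>

theorem theorem3p3:
  fixes G J :: "'a::banach \<Rightarrow> real"
    and G' J' :: "'a \<Rightarrow> 'a \<Rightarrow>\<^sub>L real"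
    and M :: "'a set"
    and K :: "(real ^ 'k) set"
    and \<Gamma> :: "(real ^ 'k \<Rightarrow> 'a) set"
    and m c :: ereal
  assumes "C1_functional G G'"
    and "M = {u. G u = 0}"
    and "\<forall>u\<in>M. G' u \<noteq> 0"
    and "C1_functional J J'"
    and "compact K"
    and "\<Gamma> \<subseteq> C0 K M"
    and "m = (SUP \<gamma>\<in>\<Gamma>. max_over (frontier K) (\<lambda>t. J (\<gamma> t)))"
    and "c = (INF \<gamma>\<in>\<Gamma>. max_over K (\<lambda>t. J (\<gamma> t)))"
    and "m < c"
    and "\<exists>a::real. m < ereal a \<and> ereal a < c \<and>
           invariant_under_homotopies_fixing \<Gamma> K M {u \<in> M. J u < a}"
  shows "\<forall>\<epsilon>>0::real. \<forall>\<gamma>\<in>\<Gamma>. max_over K (\<lambda>t. J (\<gamma> t)) < c + ereal (\<epsilon> / 2) \<longrightarrow>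
           (\<exists>u\<in>M. \<bar>ereal (J u) - c\<bar> < ereal \<epsilon> \<and>
                  dual_norm_on (tangent_space G' u) (constrained_derivative G' J' u) < ennreal (sqrt \<epsilon>) \<and>
                  infdist u (\<gamma> ` K) < sqrt \<epsilon>)"
proof (intro allI impI ballI, rule ccontr)
  note G = assms(1) and M = assms(2) and J = assms(4) and K = assms(5)
  fix \<epsilon> :: real and \<gamma> assume "0 < \<epsilon>" and \<gamma>: "\<gamma> \<in> \<Gamma>"
    and less: "max_over K (\<lambda>t. J (\<gamma> t)) < c + ereal (\<epsilon> / 2)"
    and contra: "\<not> (\<exists>u\<in>M. \<bar>ereal (J u) - c\<bar> < ereal \<epsilon> \<and>
                  dual_norm_on (tangent_space G' u) (constrained_derivative G' J' u) < ennreal (sqrt \<epsilon>) \<and>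
                  infdist u (\<gamma> ` K) < sqrt \<epsilon>)"
  obtain a :: real where "ereal a < c"
    and inv: "invariant_under_homotopies_fixing \<Gamma> K M {u \<in> M. J u < a}"
    using assms(10) by blast
  have c_le: "c \<le> max_over K (\<lambda>t. J (\<beta> t))" if "\<beta> \<in> \<Gamma>" for \<beta>
    using that unfolding assms(8) by (rule INF_lower)
  \<comment> \<open>Over an empty \<open>K\<close> the maximum is minus infinity, which contradicts
    the real lower bound \<open>a\<close> for \<open>c\<close>.\<close>
  have "K \<noteq> {}"
  proof
    assume "K = {}"
    then have "c \<le> - \<infinity>" using c_le[OF \<gamma>] by (simp add: max_over_def bot_ereal_def)
    with \<open>ereal a < c\<close> show False by simp
  qed
  have cont: "continuous_on K \<beta>" and into: "\<And>t. t \<in> K \<Longrightarrow> \<beta> t \<in> M" if "\<beta> \<in> \<Gamma>" for \<beta>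
    using that assms(6) by (auto simp: C0_def PiE_iff)
  define F where "F \<beta> = (SUP t\<in>K. J (\<beta> t))" for \<beta>
  have contJ: "continuous_on K (\<lambda>t. J (\<beta> t))" if "\<beta> \<in> \<Gamma>" for \<beta>
    using continuous_on_compose2[OF C1_functional_continuous_on[OF J, of UNIV] cont[OF that]] by simp
  note max = max_over_eq_cSUP[OF K \<open>K \<noteq> {}\<close> contJ, folded F_def]
  obtain c0 where c0: "c = ereal c0"
    using \<open>ereal a < c\<close> c_le[OF \<gamma>] max(1)[OF \<gamma>] by (cases c) auto
  have "a < c0" using \<open>ereal a < c\<close> c0 by simp
  have F\<gamma>: "F \<gamma> < c0 + \<epsilon> / 2" using less max(1)[OF \<gamma>] c0 by simp
  have F_ge: "c0 \<le> F \<beta>" if "\<beta> \<in> \<Gamma>" for \<beta> using c_le[OF that] max(1)[OF that] c0 by simp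
  have F_le: "F \<beta> \<le> b" if "\<beta> \<in> \<Gamma>" "\<And>t. t \<in> K \<Longrightarrow> J (\<beta> t) \<le> b" for \<beta> b
    using max(2)[OF that(1)] that(2) by metis
  define q where "q = sqrt \<epsilon>"
  have q: "0 < q" "q * q = \<epsilon>" using \<open>0 < \<epsilon>\<close> by (auto simp: q_def)

  \<comment> \<open>The slope \<open>q / 2\<close> keeps the limit within distance \<open>q\<close> of \<open>\<gamma>\<close>, since \<open>F \<gamma> - c0 < q * q / 2\<close>.\<close>
  define R where "R \<alpha> \<beta> \<longleftrightarrow> (\<forall>t\<in>K. q / 2 * dist (\<alpha> t) (\<beta> t) \<le> F \<alpha> - F \<beta>)" for \<alpha> \<beta> :: "real ^ 'k \<Rightarrow> 'a"
  obtain x where x0: "x 0 = \<gamma>" and x\<Gamma>: "\<And>n. x n \<in> \<Gamma>" and Rx: "\<And>n. R (x n) (x (Suc n))"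
    and near_min: "\<And>n \<beta>. \<beta> \<in> \<Gamma> \<Longrightarrow> R (x n) \<beta> \<Longrightarrow> F (x (Suc n)) \<le> F \<beta> + (1/2) ^ n"
    using ekeland_sequence[OF \<gamma>, of c0 F R] F_ge by (auto simp: R_def)
  have chain: "q / 2 * dist (x i t) (x (i + d) t) \<le> F (x i) - F (x (i + d))" if "t \<in> K" for i d t
  proof (induction d)
    case (Suc d)
    have "q / 2 * dist (x i t) (x (i + Suc d) t)
        \<le> q / 2 * dist (x i t) (x (i + d) t) + q / 2 * dist (x (i + d) t) (x (Suc (i + d)) t)"
      using q dist_triangle[of "x i t" "x (i + Suc d) t" "x (i + d) t"]
      by (simp flip: distrib_left)
    then show ?case using Suc Rx[of "i + d"] that by (auto simp: R_def)
  qed simp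
  have "decseq (\<lambda>n. F (x n))"
  proof (rule decseq_SucI)
    fix n
    obtain t where "t \<in> K" using \<open>K \<noteq> {}\<close> by blast
    then have "0 \<le> q / 2 * dist (x n t) (x (Suc n) t)" "q / 2 * dist (x n t) (x (Suc n) t) \<le> F (x n) - F (x (Suc n))"
      using Rx[of n] q by (auto simp: R_def)
    then show "F (x (Suc n)) \<le> F (x n)" by linarith
  qed
  \<comment> \<open>The limit \<open>l\<close> may exceed \<open>c0\<close>, so the levels below are
    measured from \<open>l\<close>.\<close>
  then obtain l where l: "(\<lambda>n. F (x n)) \<longlonglongrightarrow> l" "\<And>n. l \<le> F (x n)"
    using decseq_convergent[of "\<lambda>n. F (x n)" c0] F_ge[OF x\<Gamma>] by blast
  have "c0 \<le> l" using LIMSEQ_le_const[OF l(1)] F_ge[OF x\<Gamma>] by blast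

  have dist_x: "q / 2 * dist (x i t) (x j t) \<le> F (x i) - l" if "t \<in> K" "i \<le> j" for i j t
    using chain[OF that(1), of i "j - i"] l(2)[of j] that(2) by simp
  have "uniformly_Cauchy_on K x"
  proof (rule uniformly_Cauchy_onI')
    fix e :: real assume "0 < e"
    then have "\<forall>\<^sub>F n in sequentially. F (x n) < l + q / 2 * e"
      using q by (intro order_tendstoD(2)[OF l(1)]) simp
    then obtain N where N: "\<And>n. n \<ge> N \<Longrightarrow> F (x n) < l + q / 2 * e"
      unfolding eventually_sequentially by blast
    have "q / 2 * dist (x i t) (x j t) < q / 2 * e" if "t \<in> K" "N \<le> i" "i < j" for t i j
      using dist_x[OF that(1), of i j] N[OF that(2)] that(3) by linarith
    then show "\<exists>N. \<forall>t\<in>K. \<forall>i\<ge>N. \<forall>j>i. dist (x i t) (x j t) < e"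
      using q by (intro exI[of _ N]) auto
  qed
  then obtain g where g: "uniform_limit K x g sequentially"
    using Cauchy_uniformly_convergent uniformly_convergent_on_def by blast
  then have contg: "continuous_on K g"
    by (rule uniform_limit_theorem[rotated]) (auto intro: always_eventually cont x\<Gamma>)
  have glim: "(\<lambda>n. x n t) \<longlonglongrightarrow> g t" if "t \<in> K" for t
    using tendsto_uniform_limitI[OF g that] .
  have "closed M"
    unfolding M by (intro closed_Collect_eq C1_functional_continuous_on[OF G] continuous_intros)
  have gM: "g ` K \<subseteq> M"
    using closed_sequentially[OF \<open>closed M\<close> into[OF x\<Gamma>] glim] by blast
  have compg: "compact (g ` K)" using compact_continuous_image[OF contg K] .
  have xM: "\<And>n t. t \<in> K \<Longrightarrow> x n t \<in> M" using into[OF x\<Gamma>] .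
  have J_le: "J (g t) \<le> l" if "t \<in> K" for t
  proof (rule LIMSEQ_le[OF _ l(1)])
    have "isCont J (g t)"
      using C1_functional_continuous_on[OF J, of UNIV] by (simp add: continuous_on_eq_continuous_at)
    then show "(\<lambda>n. J (x n t)) \<longlonglongrightarrow> J (g t)" using isCont_tendsto_compose glim[OF that] by blast
  qed (use max(3)[OF x\<Gamma> that] in auto)
  have dist_g: "dist (g t) (\<gamma> t) < q" if "t \<in> K" for t
  proof -
    have "(\<lambda>n. q / 2 * dist (x 0 t) (x n t)) \<longlonglongrightarrow> q / 2 * dist (x 0 t) (g t)"
      by (intro tendsto_intros glim that)
    then have "q / 2 * dist (\<gamma> t) (g t) \<le> F \<gamma> - l"
      using dist_x[OF that, of 0] by (intro LIMSEQ_le_const2) (auto simp flip: x0)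
    also have "\<dots> < q / 2 * q" using F\<gamma> \<open>c0 \<le> l\<close> q by simp
    finally show ?thesis using q(1) by (simp add: dist_commute)
  qed

  \<comment> \<open>The bound \<open>\<epsilon> / 2\<close> keeps the values of \<open>J\<close> on
    \<open>A\<close> within \<open>\<epsilon>\<close> of \<open>c0\<close>; the other bound keeps
    \<open>A\<close> above level \<open>a\<close>, so that the deformation can fix the sublevel
    set.\<close>
  define \<delta> where "\<delta> = min (\<epsilon> / 2) ((c0 - a) / 2)"
  have \<delta>: "0 < \<delta>" "\<delta> \<le> \<epsilon> / 2" "a < l - \<delta>"
    using \<open>0 < \<epsilon>\<close> \<open>a < c0\<close> \<open>c0 \<le> l\<close> by (auto simp: \<delta>_def min_def field_simps)
  \<comment> \<open>\<open>g\<close> need not belong to \<open>\<Gamma>\<close>; the deformation is constructed along \<open>g\<close> but applied to \<open>x n\<close>.\<close>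
  define A where "A = g ` K \<inter> {u. l - \<delta> \<le> J u}"
  have "compact A"
    unfolding A_def
    by (intro compact_Int_closed compg closed_Collect_le C1_functional_continuous_on[OF J] continuous_intros)
  have "A \<subseteq> M" using gM by (auto simp: A_def)
  \<comment> \<open>Points of \<open>A\<close> satisfy the first and third conclusions, so
    \<open>contra\<close> bounds the dual norm below by \<open>q\<close>. The supremum may not be
    attained, whence the loss to \<open>7/8 * q\<close>; a sign change of \<open>v\<close> turns a
    large derivative into descent.\<close>
  have descent: "\<exists>v. norm v = 1 \<and> G' u v = 0 \<and> J' u v < - (7/8 * q)" if u: "u \<in> A" for u
  proof -
    obtain t where t: "t \<in> K" "u = g t" using u by (auto simp: A_def)
    have "l - \<delta> \<le> J u" "J u \<le> l" using u J_le t by (auto simp: A_def)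
    then have "\<bar>ereal (J u) - c\<bar> < ereal \<epsilon>"
      using \<delta> \<open>c0 \<le> l\<close> F\<gamma> l(2)[of 0] \<open>0 < \<epsilon>\<close> by (auto simp: c0 x0)
    moreover have "infdist u (\<gamma> ` K) < sqrt \<epsilon>"
      using infdist_le[of "\<gamma> t" "\<gamma> ` K" u] dist_g[OF t(1)] t by (auto simp: q_def)
    ultimately have "ennreal q \<le> dual_norm_on (tangent_space G' u) (constrained_derivative G' J' u)"
      using contra u \<open>A \<subseteq> M\<close> by (force simp: q_def not_less)
    moreover have "ennreal (7/8 * q) < ennreal q" using q by (simp add: ennreal_less_iff)
    ultimately have "ennreal (7/8 * q) < dual_norm_on (tangent_space G' u) (constrained_derivative G' J' u)"
      by (rule less_le_trans[rotated])
    then obtain v where v: "v \<in> tangent_space G' u" "norm v = 1"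
      "ennreal (7/8 * q) < ennreal \<bar>constrained_derivative G' J' u v\<bar>"
      unfolding dual_norm_on_def less_SUP_iff by blast
    then have "7/8 * q < \<bar>J' u v\<bar>"
      using q by (simp add: ennreal_less_iff constrained_derivative_def)
    moreover have "G' u v = 0" using v by (simp add: tangent_space_def)
    ultimately have "J' u v < - (7/8 * q) \<or> J' u (- v) < - (7/8 * q)" "G' u (- v) = 0"
      by (auto simp: blinfun.minus_right)
    with \<open>G' u v = 0\<close> v(2) show ?thesis by (metis norm_minus_cancel)
  qed
  have above: "a < J u" if "u \<in> A" for u using that \<delta> by (auto simp: A_def)
  have "0 < \<delta> / q" using \<delta> q by simp
  have regular: "G' u \<noteq> 0" if "u \<in> A" for u using that assms(3) \<open>A \<subseteq> M\<close> by blast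
  obtain s H where s: "0 < s" "s \<le> \<delta> / q"
    and H: "continuous_on ({0..1::real} \<times> M) H" "H \<in> {0..1} \<times> M \<rightarrow> M" "\<And>u. u \<in> M \<Longrightarrow> H (0, u) = u"
      "\<And>\<sigma> u. \<sigma> \<in> {0..1} \<Longrightarrow> u \<in> M \<Longrightarrow> J u \<le> a \<Longrightarrow> H (\<sigma>, u) = u"
    and Hdist: "\<And>u. u \<in> M \<Longrightarrow> dist (H (1, u)) u \<le> 9/8 * s"
    and HJ: "\<And>u. u \<in> M \<Longrightarrow> J (H (1, u)) \<le> J u"
      "\<And>u. u \<in> A \<Longrightarrow> J (H (1, u)) \<le> J u - 3/4 * q * s"
    by (rule constrained_deformation[OF G J M \<open>compact A\<close> \<open>A \<subseteq> M\<close> regular above descent q(1) \<open>0 < \<delta> / q\<close>])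
      (assumption | (rule that; assumption))+
  have HM: "H (1, u) \<in> M" if "u \<in> M" for u using H(2) that by auto
  have H\<Gamma>: "(\<lambda>t\<in>K. H (1, \<beta> t)) \<in> \<Gamma>" if "\<beta> \<in> \<Gamma>" for \<beta>
    using inv[unfolded invariant_under_homotopies_fixing_def, rule_format, of H \<beta>] H that by auto
  \<comment> \<open>In units of \<open>e\<close> the descent \<open>3/4 * q * s\<close> is 24, and
    the Ekeland cost \<open>q / 2 * (9/8 * s)\<close> is 18. Replacing \<open>g\<close> by
    \<open>x n\<close> loses at most one unit, so 23 still covers the cost. Off \<open>A\<close> the
    values lie below \<open>l\<close> by \<open>\<delta>\<close>, which is at least 32
    units.\<close>
  define e where "e = q * s / 32"
  have "0 < e" using q s by (simp add: e_def)
  have drop: "J (H (1, g t)) \<le> l - 24 * e" if "t \<in> K" for t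
  proof (cases "g t \<in> A")
    case True
    then show ?thesis using HJ(2)[OF True] J_le[OF that] by (simp add: e_def)
  next
    case False
    then have "J (g t) < l - \<delta>" using that by (auto simp: A_def)
    moreover have "q * s \<le> \<delta>" using s q by (simp add: field_simps)
    ultimately show ?thesis using HJ(1)[of "g t"] gM that \<open>0 < e\<close> unfolding e_def by fastforce
  qed
  have contH: "continuous_on M (\<lambda>u. H (1, u))"
    by (rule continuous_on_compose2[OF H(1)]) (auto intro!: continuous_intros)
  have "continuous_on M (\<lambda>u. J (H (1, u)))"
    by (rule continuous_on_compose2[OF C1_functional_continuous_on[OF J, of UNIV] contH]) auto
  then have limJ: "uniform_limit K (\<lambda>n t. J (H (1, x n t))) (\<lambda>t. J (H (1, g t))) sequentially"
    using uniform_limit_compose_near_compact[OF g compg gM _ xM] by blast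

  have "(\<lambda>n. F (x n) - F (x (Suc n))) \<longlonglongrightarrow> l - l"
    using l(1) by (intro tendsto_diff LIMSEQ_Suc)
  then have step: "\<forall>\<^sub>F n in sequentially. F (x n) - F (x (Suc n)) < e"
    using \<open>0 < e\<close> by (intro order_tendstoD(2)) auto
  have "(\<lambda>n. (1/2) ^ n :: real) \<longlonglongrightarrow> 0" by (intro LIMSEQ_power_zero) simp
  then have "\<forall>\<^sub>F n in sequentially. (1/2) ^ n < e"
    using \<open>0 < e\<close> by (intro order_tendstoD(2)) auto
  with step uniform_limitD[OF limJ \<open>0 < e\<close>] have "\<forall>\<^sub>F n in sequentially. False"
  proof eventually_elim
    case (elim n)
    let ?\<beta> = "\<lambda>t\<in>K. H (1, x n t)"
    have "F ?\<beta> \<le> l - 23 * e"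
    proof (rule F_le[OF H\<Gamma>[OF x\<Gamma>]])
      fix t assume "t \<in> K"
      with elim(2) drop[of t] show "J (?\<beta> t) \<le> l - 23 * e" by (force simp: dist_real_def)
    qed
    then have F\<beta>: "F ?\<beta> \<le> F (x n) - 23 * e" using l(2)[of n] by linarith
    have "R (x n) ?\<beta>"
      unfolding R_def
    proof
      fix t assume "t \<in> K"
      then have "q / 2 * dist (x n t) (?\<beta> t) \<le> q / 2 * (9/8 * s)"
        using Hdist[OF xM] q by (intro mult_left_mono) (auto simp: dist_commute)
      also have "\<dots> \<le> 23 * e" using q s by (simp add: e_def)
      finally show "q / 2 * dist (x n t) (?\<beta> t) \<le> F (x n) - F ?\<beta>" using F\<beta> by linarith
    qed
    \<comment> \<open>The competitor forces a decrease of more than 22 units from \<open>x n\<close>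
      to \<open>x (Suc n)\<close>, while \<open>step\<close> allows less than one.\<close>
    from near_min[OF H\<Gamma>[OF x\<Gamma>] this] F\<beta> elim \<open>0 < e\<close> show False by linarith
  qed
  then show False by simp
qed

end
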